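(* Consider the adjacency-list model augmented with $\texttt{JUMP}$, $\texttt{IN-SORTED}$ and $\texttt{ADJ}$. For any $n$ and $m$ with $n\le m\le n^2$ and any $\delta\in(0,1]$, there exists a directed graph $G=(V,E)$ with $\Theta(n)$ nodes, $\Theta(m)$ edges, and a node $s\in V$, such that for any algorithm solving the single-source problem, the expected running time on $G$ with source $s$ and approximation threshold $\delta$ is $\Omega(\min\{m,1/\delta\})$.
   Context: Fix a constant $\alpha\in(0,1)$. For a directed graph $G=(V,E)$, an $\alpha$-discounted random walk from a node $s$: at each step, with probability $\alpha$ it terminates at the current node, and otherwise it moves to a uniformly random out-neighbor of the current node. $\pi(s,t)$ is the probability that such a walk from $s$ terminates at $t$. Adjacency-list model: an algorithm accesses $G$ only through constant-time queries $\texttt{DEG-IN}(u)$, $\texttt{DEG-OUT}(u)$ (in-/out-degree of $u$), $\texttt{IN}(u,i)$, $\texttt{OUT}(u,i)$ ($i$-th in-/out-neighbor of $u$). Additional queries: $\texttt{ADJ}(u,v)$ returns whether $(u,v)\in E$; $\texttt{IN-SORTED}(u,i)$ returns the $i$-th in-neighbor of $u$ when in-neighbors are sorted by out-degree; $\texttt{JUMP}()$ returns a uniformly random node of $V$. Single-source problem: given $G$ (via queries), a source $s\in V$ and $\delta\in(0,1]$, output estimates $\hat\pi(s,t)$ for all $t\in V$ such that for each $t$, $\Pr\{|\hat\pi(s,t)-\pi(s,t)|\ge\varepsilon\max\{\pi(s,t),\delta\}\}\le p_f$, where $\varepsilon,p_f$ are fixed small constants; an algorithm solves the problem if this holds for every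 input. *)

theory Defs
  imports "HOL-Probability.Probability" "Graph_Theory.Pair_Digraph"
begin

text \<open>
  Self-loops are permitted. A walk has to be able to move on from every node, so every node has an
  out-neighbour.
\<close>

definition walk_graph :: "nat pair_pre_digraph \<Rightarrow> bool" where
  "walk_graph G \<longleftrightarrow>
     pair_fin_digraph G \<and> (\<forall>u\<in>pverts G. out_degree (with_proj G) u \<ge> 1)"

datatype walk_state = At nat | Stopped nat

context
  fixes \<alpha> :: real and G :: "nat pair_pre_digraph"
begin

fun walk_step :: "walk_state \<Rightarrow> walk_state pmf" where
  "walk_step (At u) =
     bind_pmf (bernoulli_pmf \<alpha>)
       (\<lambda>stop. if stop then return_pmf (Stopped u)
               else map_pmf At (pmf_of_set {v. (u, v) \<in> parcs G}))"
| "walk_step (Stopped u) = return_pmf (Stopped u)"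

fun walk_after :: "nat \<Rightarrow> nat \<Rightarrow> walk_state pmf" where
  "walk_after s 0 = return_pmf (At s)"
| "walk_after s (Suc k) = bind_pmf (walk_after s k) walk_step"

text \<open>
  The probability of having stopped at \<open>t\<close> is nondecreasing in the number of steps, so the
  supremum is the probability that the walk ever terminates at \<open>t\<close>.
\<close>

definition ppr :: "nat \<Rightarrow> nat \<Rightarrow> real" where
  "ppr s t = (SUP k. pmf (walk_after s k) (Stopped t))"

end

text \<open>
  The queries see the neighbours of a node in an order that the graph itself does not determine
  (for \<open>sorted_in_list\<close>: not among in-neighbours of equal out-degree).
  An input is a graph together with such a choice of lists.
\<close>

record adj_lists =
  in_list :: "nat \<Rightarrow> nat list"
  out_list :: "nat \<Rightarrow> nat list"
  sorted_in_list :: "nat \<Rightarrow> nat list"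

definition adj_lists_of :: "nat pair_pre_digraph \<Rightarrow> adj_lists \<Rightarrow> bool" where
  "adj_lists_of G L \<longleftrightarrow> (\<forall>u\<in>pverts G.
     distinct (in_list L u) \<and> set (in_list L u) = {v. (v, u) \<in> parcs G} \<and>
     distinct (out_list L u) \<and> set (out_list L u) = {v. (u, v) \<in> parcs G} \<and>
     distinct (sorted_in_list L u) \<and> set (sorted_in_list L u) = {v. (v, u) \<in> parcs G} \<and>
     sorted (map (out_degree (with_proj G)) (sorted_in_list L u)))"

datatype query =
    DEG_IN nat
  | DEG_OUT nat
  | IN nat nat
  | OUT nat nat
  | ADJ nat nat
  | IN_SORTED nat nat
  | JUMP

datatype answer = Number nat | Node nat | Truth bool | Invalid

text \<open>Neighbours are indexed from 0.\<close>

definition entry :: "nat set \<Rightarrow> (nat \<Rightarrow> nat list) \<Rightarrow> nat \<Rightarrow> nat \<Rightarrow> answer" where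
  "entry V l u i = (if u \<in> V \<and> i < length (l u) then Node (l u ! i) else Invalid)"

fun reply :: "nat pair_pre_digraph \<Rightarrow> adj_lists \<Rightarrow> query \<Rightarrow> answer pmf" where
  "reply G L (DEG_IN u) =
     return_pmf (if u \<in> pverts G then Number (in_degree (with_proj G) u) else Invalid)"
| "reply G L (DEG_OUT u) =
     return_pmf (if u \<in> pverts G then Number (out_degree (with_proj G) u) else Invalid)"
| "reply G L (IN u i) = return_pmf (entry (pverts G) (in_list L) u i)"
| "reply G L (OUT u i) = return_pmf (entry (pverts G) (out_list L) u i)"
| "reply G L (ADJ u v) = return_pmf (Truth ((u, v) \<in> parcs G))"
| "reply G L (IN_SORTED u i) = return_pmf (entry (pverts G) (sorted_in_list L) u i)"
| "reply G L JUMP = map_pmf Node (pmf_of_set (pverts G))"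

text \<open>
  A randomized adaptive algorithm chooses its next action from the answers it has received so far
  (most recent first). Its internal randomness consists of \<open>Sample\<close> actions, whose
  results are recorded among the answers. \<open>Halt e\<close> outputs the estimates \<open>e\<close>.
\<close>

datatype action = Query query | Sample "nat pmf" | Halt "nat \<Rightarrow> real"

type_synonym strategy = "answer list \<Rightarrow> action"

text \<open>
  The arguments are the set of node names, the source and the threshold; the edges are accessible
  through queries only.
\<close>

type_synonym algorithm = "nat set \<Rightarrow> nat \<Rightarrow> real \<Rightarrow> strategy"

context
  fixes G :: "nat pair_pre_digraph" and L :: adj_lists and \<sigma> :: strategy
begin

definition run_step :: "answer list \<Rightarrow> answer list pmf" where
  "run_step h = (case \<sigma> h of
       Query q \<Rightarrow> map_pmf (\<lambda>a. a # h) (reply G L q)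
     | Sample p \<Rightarrow> map_pmf (\<lambda>k. Number k # h) p
     | Halt e \<Rightarrow> return_pmf h)"

fun run_after :: "nat \<Rightarrow> answer list pmf" where
  "run_after 0 = return_pmf []"
| "run_after (Suc k) = bind_pmf (run_after k) run_step"

text \<open>
  The probability that the run halts with an output satisfying \<open>P\<close>; a run that
  never halts does not contribute. The sequence is nondecreasing.
\<close>

definition output_prob :: "((nat \<Rightarrow> real) \<Rightarrow> bool) \<Rightarrow> real" where
  "output_prob P =
     (SUP k. measure_pmf.prob (run_after k) {h. \<exists>e. \<sigma> h = Halt e \<and> P e})"

text \<open>
  Every action, including the final \<open>Halt\<close>, takes one unit of time; computation between
  actions is free. A run that halts with history \<open>h\<close> has taken time
  \<open>length h + 1\<close>; the supremum is the expectation by monotone convergence, and it is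
  infinite if the run fails to halt with positive probability.
\<close>

definition expected_time :: ennreal where
  "expected_time = (SUP k. \<integral>\<^sup>+ h. of_nat (length h + 1) \<partial>measure_pmf (run_after k))"

end

definition solves_single_source :: "real \<Rightarrow> real \<Rightarrow> real \<Rightarrow> algorithm \<Rightarrow> bool" where
  "solves_single_source \<alpha> \<epsilon> p\<^sub>f A \<longleftrightarrow>
     (\<forall>G L s \<delta>. walk_graph G \<and> adj_lists_of G L \<and> s \<in> pverts G \<and> 0 < \<delta> \<and> \<delta> \<le> 1 \<longrightarrow>
       (\<forall>t\<in>pverts G.
          1 - output_prob G L (A (pverts G) s \<delta>)
                (\<lambda>e. \<not> \<bar>e t - ppr \<alpha> G s t\<bar> \<ge> \<epsilon> * max (ppr \<alpha> G s t) \<delta>) \<le> p\<^sub>f))"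

end

theory Submission
  imports Defs
begin

text \<open>
  The hard input consists of two disjoint copies of one digraph, in which the source reaches each of
  \<open>K = \<Theta>(min m (1/\<delta>))\<close> critical arcs with probability \<open>\<Theta>(1/K)\<close>. Crossing
  the two copies of one critical arc makes a node of the other copy reachable with probability at
  least \<open>\<delta> / (1 - \<epsilon>)\<close>, whereas before it was unreachable, so the estimate at this node has
  to change. Crossing preserves all degrees, and each query has a different reply for at most one of
  the \<open>K\<close> crossed inputs. Hence an algorithm has to ask, with probability bounded below, a query
  specific to each of the critical arcs, which takes \<open>\<Omega>(K)\<close> queries in expectation.
\<close>

section \<open>Indistinguishable inputs\<close>

text \<open>Histories have the most recent answer first, so the answer \<open>a\<close> was produced
  by the action that \<open>\<sigma>\<close> chose at \<open>h\<close>. Only answered queries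
  count.\<close>

fun asked :: "strategy \<Rightarrow> (query \<Rightarrow> bool) \<Rightarrow> answer list \<Rightarrow> bool" where
  "asked \<sigma> D [] \<longleftrightarrow> False"
| "asked \<sigma> D (a # h) \<longleftrightarrow> asked \<sigma> D h \<or> (\<exists>q. \<sigma> h = Query q \<and> D q)"

text \<open>Two runs whose replies differ only on \<open>D\<close> have the same law until a query
  in \<open>D\<close> is asked. Allowing every \<open>f\<close> that vanishes afterwards makes the
  induction on the last step work: integrating \<open>f\<close> over one step gives a function that
  vanishes on the same histories, because \<open>asked\<close> persists.\<close>

lemma nn_integral_run_after_eq:
  assumes same: "\<And>q. \<not> D q \<Longrightarrow> reply G L q = reply G' L' q"
    and vanish: "\<And>h. asked \<sigma> D h \<Longrightarrow> f h = (0::ennreal)"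
  shows "(\<integral>\<^sup>+h. f h \<partial>measure_pmf (run_after G L \<sigma> k)) =
    (\<integral>\<^sup>+h. f h \<partial>measure_pmf (run_after G' L' \<sigma> k))"
  using vanish
proof (induction k arbitrary: f)
  case 0
  then show ?case by simp
next
  case (Suc k)
  have zero: "(\<integral>\<^sup>+h'. f h' \<partial>measure_pmf (run_step G'' L'' \<sigma> h)) = 0" if "asked \<sigma> D h" for G'' L'' h
    using that Suc.prems
    by (auto simp: run_step_def split: action.split)
  have eq: "(\<integral>\<^sup>+h'. f h' \<partial>measure_pmf (run_step G L \<sigma> h)) =
    (\<integral>\<^sup>+h'. f h' \<partial>measure_pmf (run_step G' L' \<sigma> h))" for h
  proof (cases "\<sigma> h")
    case (Query q)
    show ?thesis
    proof (cases "D q")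
      case True
      with Query have "f (a # h) = 0" for a
        by (intro Suc.prems) auto
      with Query show ?thesis by (simp add: run_step_def)
    next
      case False
      with Query same show ?thesis by (simp add: run_step_def)
    qed
  qed (simp_all add: run_step_def)
  show ?case
    using Suc.IH[of "\<lambda>h. \<integral>\<^sup>+h'. f h' \<partial>measure_pmf (run_step G L \<sigma> h)"] zero
    by (simp add: eq)
qed

lemma prob_run_after_not_asked_eq:
  assumes "\<And>q. \<not> D q \<Longrightarrow> reply G L q = reply G' L' q"
  shows "measure_pmf.prob (run_after G L \<sigma> k) {h \<in> S. \<not> asked \<sigma> D h} =
    measure_pmf.prob (run_after G' L' \<sigma> k) {h \<in> S. \<not> asked \<sigma> D h}"
proof -
  have "emeasure (measure_pmf (run_after G L \<sigma> k)) {h \<in> S. \<not> asked \<sigma> D h} =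
    emeasure (measure_pmf (run_after G' L' \<sigma> k)) {h \<in> S. \<not> asked \<sigma> D h}"
    using nn_integral_run_after_eq[OF assms, of D \<sigma> "indicator {h \<in> S. \<not> asked \<sigma> D h}" k]
    by simp
  then show ?thesis by (simp add: measure_def)
qed

text \<open>The event of not having asked has the same probability in both runs, hence so has its
  complement. The price of exchanging the inputs is thus measured on \<open>G\<close> alone, which
  later allows many inputs to be charged to a single run.\<close>

lemma prob_run_after_le:
  assumes "\<And>q. \<not> D q \<Longrightarrow> reply G L q = reply G' L' q"
  shows "measure_pmf.prob (run_after G' L' \<sigma> k) S \<le>
    measure_pmf.prob (run_after G L \<sigma> k) S + measure_pmf.prob (run_after G L \<sigma> k) {h. asked \<sigma> D h}"
proof -
  let ?p = "measure_pmf.prob (run_after G L \<sigma> k)" and ?p' = "measure_pmf.prob (run_after G' L' \<sigma> k)"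
  have compl: "{h. asked \<sigma> D h} = UNIV - {h \<in> UNIV. \<not> asked \<sigma> D h}" by auto
  have "?p' S \<le> ?p' ({h \<in> S. \<not> asked \<sigma> D h} \<union> {h. asked \<sigma> D h})"
    by (intro measure_pmf.finite_measure_mono) auto
  also have "\<dots> \<le> ?p' {h \<in> S. \<not> asked \<sigma> D h} + ?p' {h. asked \<sigma> D h}"
    by (intro measure_Un_le) auto
  also have "\<dots> = ?p {h \<in> S. \<not> asked \<sigma> D h} + ?p {h. asked \<sigma> D h}"
    using prob_run_after_not_asked_eq[OF assms, of D \<sigma> k S]
      prob_run_after_not_asked_eq[OF assms, of D \<sigma> k UNIV]
      measure_pmf.prob_compl[of "{h \<in> UNIV. \<not> asked \<sigma> D h}" "run_after G L \<sigma> k"]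
      measure_pmf.prob_compl[of "{h \<in> UNIV. \<not> asked \<sigma> D h}" "run_after G' L' \<sigma> k"]
    unfolding compl by simp
  also have "?p {h \<in> S. \<not> asked \<sigma> D h} \<le> ?p S"
    by (intro measure_pmf.finite_measure_mono) auto
  finally show ?thesis by simp
qed

section \<open>Truncation to finitely many steps and counting of queries\<close>

text \<open>\<open>run_step\<close> leaves a halted history unchanged, so the output, once given,
  stays.\<close>

lemma incseq_halted_prob:
  "incseq (\<lambda>k. measure_pmf.prob (run_after G L \<sigma> k) {h. \<exists>e. \<sigma> h = Halt e \<and> P e})"
proof (rule incseq_SucI)
  fix k
  let ?S = "{h. \<exists>e. \<sigma> h = Halt e \<and> P e}"
  have "emeasure (measure_pmf (run_after G L \<sigma> k)) ?S =
      (\<integral>\<^sup>+h. indicator ?S h \<partial>measure_pmf (run_after G L \<sigma> k))"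
    by simp
  also have "\<dots> \<le> (\<integral>\<^sup>+h. emeasure (measure_pmf (run_step G L \<sigma> h)) ?S \<partial>measure_pmf (run_after G L \<sigma> k))"
    by (intro nn_integral_mono) (auto simp: run_step_def indicator_def)
  also have "\<dots> = emeasure (measure_pmf (run_after G L \<sigma> (Suc k))) ?S"
    by simp
  finally show "measure_pmf.prob (run_after G L \<sigma> k) ?S \<le> measure_pmf.prob (run_after G L \<sigma> (Suc k)) ?S"
    by (simp add: measure_pmf.emeasure_eq_measure)
qed

lemma eventually_halted_prob_gt:
  assumes "x < output_prob G L \<sigma> P"
  shows "\<forall>\<^sub>F k in sequentially.
    x < measure_pmf.prob (run_after G L \<sigma> k) {h. \<exists>e. \<sigma> h = Halt e \<and> P e}"
proof -
  have "bdd_above (range (\<lambda>k. measure_pmf.prob (run_after G L \<sigma> k) {h. \<exists>e. \<sigma> h = Halt e \<and> P e}))"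
    by (rule bdd_aboveI[of _ 1]) auto
  from LIMSEQ_incseq_SUP[OF this incseq_halted_prob] show ?thesis
    using assms unfolding output_prob_def by (rule order_tendstoD(1))
qed

text \<open>Each answer in the history comes from at most one query, which can be charged to at most
  one index.\<close>

lemma card_asked_le_length:
  assumes "finite I" and "\<And>q. card {i \<in> I. D i q} \<le> 1"
  shows "card {i \<in> I. asked \<sigma> (D i) h} \<le> length h"
proof (induction h)
  case (Cons a h)
  have "{i \<in> I. asked \<sigma> (D i) (a # h)} =
    {i \<in> I. asked \<sigma> (D i) h} \<union> {i \<in> I. \<exists>q. \<sigma> h = Query q \<and> D i q}"
    by auto
  moreover have "card {i \<in> I. \<exists>q. \<sigma> h = Query q \<and> D i q} \<le> 1"
    using assms(2) by (cases "\<sigma> h") auto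
  ultimately show ?case
    using card_Un_le[of "{i \<in> I. asked \<sigma> (D i) h}" "{i \<in> I. \<exists>q. \<sigma> h = Query q \<and> D i q}"] Cons.IH
    by simp
qed simp

lemma one_le_expected_time: "1 \<le> expected_time G L \<sigma>"
proof -
  have "(\<integral>\<^sup>+h. of_nat (length h + 1) \<partial>measure_pmf (run_after G L \<sigma> 0)) \<le> expected_time G L \<sigma>"
    unfolding expected_time_def by (rule SUP_upper) simp
  then show ?thesis by simp
qed

text \<open>On \<open>G\<close> the output satisfies \<open>P i\<close>, hence not
  \<open>Q i\<close>, with probability at least \<open>1 - p\<close>; on \<open>G' i\<close> it
  satisfies \<open>Q i\<close> with probability at least \<open>1 - p\<close>. The gap
  \<open>1 - 2 * p\<close> must come from runs that ask a query in \<open>D i\<close>. Summing over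
  \<open>I\<close> bounds the expected number of queries from below.\<close>

lemma expected_time_ge_of_indistinguishable:
  assumes "finite I"
    and same: "\<And>i q. i \<in> I \<Longrightarrow> \<not> D i q \<Longrightarrow> reply G L q = reply (G' i) (L' i) q"
    and one: "\<And>q. card {i \<in> I. D i q} \<le> 1"
    and P: "\<And>i. i \<in> I \<Longrightarrow> 1 - output_prob G L \<sigma> (P i) \<le> p"
    and Q: "\<And>i. i \<in> I \<Longrightarrow> 1 - output_prob (G' i) (L' i) \<sigma> (Q i) \<le> p"
    and disj: "\<And>i e. i \<in> I \<Longrightarrow> P i e \<Longrightarrow> Q i e \<Longrightarrow> False"
    and p: "p < 1/2"
  shows "ennreal (real (card I) * ((1 - 2 * p) / 2)) \<le> expected_time G L \<sigma>"
proof -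
  \<comment> \<open>The slack for replacing the suprema by one finite \<open>k\<close>. It is spent
    once on \<open>G\<close> and once on \<open>G' i\<close>, so half of the gap
    \<open>4 * \<eta>\<close> remains.\<close>
  define \<eta> where "\<eta> = (1 - 2 * p) / 4"
  have "\<eta> > 0" using p by (simp add: \<eta>_def)
  let ?halt = "\<lambda>P. {h. \<exists>e. \<sigma> h = Halt e \<and> P e}"
  \<comment> \<open>Finiteness of \<open>I\<close> yields one number of steps that serves all inputs
    at once.\<close>
  have "\<forall>\<^sub>F k in sequentially. \<forall>i\<in>I.
      1 - p - \<eta> < measure_pmf.prob (run_after G L \<sigma> k) (?halt (P i)) \<and>
      1 - p - \<eta> < measure_pmf.prob (run_after (G' i) (L' i) \<sigma> k) (?halt (Q i))"
  proof (intro eventually_ball_finite ballI eventually_conj eventually_halted_prob_gt)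
    show "1 - p - \<eta> < output_prob G L \<sigma> (P i)" if "i \<in> I" for i
      using P[OF that] \<open>\<eta> > 0\<close> by simp
    show "1 - p - \<eta> < output_prob (G' i) (L' i) \<sigma> (Q i)" if "i \<in> I" for i
      using Q[OF that] \<open>\<eta> > 0\<close> by simp
  qed fact
  then obtain k where k: "\<And>i. i \<in> I \<Longrightarrow>
        1 - p - \<eta> < measure_pmf.prob (run_after G L \<sigma> k) (?halt (P i))"
      "\<And>i. i \<in> I \<Longrightarrow>
        1 - p - \<eta> < measure_pmf.prob (run_after (G' i) (L' i) \<sigma> k) (?halt (Q i))"
    by (auto simp: eventually_sequentially)
  let ?M = "measure_pmf (run_after G L \<sigma> k)"
  have asked: "2 * \<eta> \<le> measure ?M {h. asked \<sigma> (D i) h}" if i: "i \<in> I" for i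
  proof -
    have "measure ?M (?halt (P i)) + measure ?M (?halt (Q i)) = measure ?M (?halt (P i) \<union> ?halt (Q i))"
      using disj[OF i] by (intro measure_pmf.finite_measure_Union[symmetric]) auto
    also have "\<dots> \<le> 1" by simp
    finally have "measure ?M (?halt (Q i)) < p + \<eta>" using k(1)[OF i] by simp
    moreover have "1 - p - \<eta> < measure ?M (?halt (Q i)) + measure ?M {h. asked \<sigma> (D i) h}"
      using k(2)[OF i] prob_run_after_le[of "D i" G L "G' i" "L' i" \<sigma> k "?halt (Q i)"] same[OF i]
      by fastforce
    ultimately show ?thesis by (simp add: \<eta>_def field_simps)
  qed
  have "ennreal (real (card I) * (2 * \<eta>)) = ennreal (\<Sum>i\<in>I. 2 * \<eta>)" by simp
  also have "\<dots> \<le> ennreal (\<Sum>i\<in>I. measure ?M {h. asked \<sigma> (D i) h})"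
    by (intro ennreal_leI sum_mono asked)
  also have "\<dots> = (\<Sum>i\<in>I. emeasure ?M {h. asked \<sigma> (D i) h})"
    by (subst sum_ennreal[symmetric]) (auto simp: measure_pmf.emeasure_eq_measure)
  also have "\<dots> = (\<Sum>i\<in>I. \<integral>\<^sup>+h. indicator {h. asked \<sigma> (D i) h} h \<partial>?M)"
    by simp
  \<comment> \<open>Exchanging sum and integral turns the probabilities into the expected number of
    indices asked for, which is at most the length of the history.\<close>
  also have "\<dots> = (\<integral>\<^sup>+h. (\<Sum>i\<in>I. indicator {h. asked \<sigma> (D i) h} h) \<partial>?M)"
    by (intro nn_integral_sum[symmetric]) auto
  also have "\<dots> = (\<integral>\<^sup>+h. of_nat (card {i \<in> I. asked \<sigma> (D i) h}) \<partial>?M)"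
    using \<open>finite I\<close> by (simp add: indicator_def sum.If_cases Int_def)
  also have "\<dots> \<le> (\<integral>\<^sup>+h. of_nat (length h + 1) \<partial>?M)"
    by (intro nn_integral_mono of_nat_mono trans_le_add1 card_asked_le_length[OF \<open>finite I\<close> one])
  also have "\<dots> \<le> expected_time G L \<sigma>"
    unfolding expected_time_def by (rule SUP_upper) simp
  also have "2 * \<eta> = (1 - 2 * p) / 2" by (simp add: \<eta>_def)
  finally show ?thesis .
qed

section \<open>Two-lifts of a digraph\<close>

text \<open>
  Node \<open>k\<close> of the base digraph has the two copies \<open>2 * k\<close> and \<open>2 * k + 1\<close>. Base arcs
  in \<open>F\<close> connect copies of different parity, all others connect copies of the same parity.
\<close>

definition lift :: "nat set \<Rightarrow> (nat \<times> nat) set \<Rightarrow> (nat \<times> nat) set \<Rightarrow> nat pair_pre_digraph" where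
  "lift W B F = \<lparr>pverts = {x. x div 2 \<in> W},
     parcs = {(x, y). (x div 2, y div 2) \<in> B \<and>
       (even x = even y \<longleftrightarrow> (x div 2, y div 2) \<notin> F)}\<rparr>"

definition twin :: "nat \<Rightarrow> nat" where
  "twin x = (if even x then x + 1 else x - 1)"

lemma twin_div_2 [simp]: "twin x div 2 = x div 2"
  by (auto simp: twin_def elim!: oddE)

lemma even_twin [simp]: "even (twin x) \<longleftrightarrow> odd x"
  by (auto simp: twin_def elim!: oddE)

lemma twin_twin [simp]: "twin (twin x) = x"
  by (auto simp: twin_def elim!: oddE)

lemma eq_of_div_2_parity:
  fixes x y :: nat
  assumes "x div 2 = y div 2" "even x = even y"
  shows "x = y"
  using assms by presburger

lemma pverts_lift [simp]: "x \<in> pverts (lift W B F) \<longleftrightarrow> x div 2 \<in> W"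
  by (simp add: lift_def)

lemma pverts_lift_eq: "pverts (lift W B F) = pverts (lift W B F')"
  by (simp add: lift_def)

lemma arc_lift [simp]: "(x, y) \<in> parcs (lift W B F) \<longleftrightarrow>
    (x div 2, y div 2) \<in> B \<and> (even x = even y \<longleftrightarrow> (x div 2, y div 2) \<notin> F)"
  by (simp add: lift_def)

lemma pverts_lift_image: "pverts (lift W B F) = (\<lambda>k. 2 * k) ` W \<union> (\<lambda>k. 2 * k + 1) ` W"
proof -
  have "x \<in> (\<lambda>k. 2 * k) ` W \<union> (\<lambda>k. 2 * k + 1) ` W" if "x div 2 \<in> W" for x
    using that by (cases "even x") (force elim!: evenE oddE)+
  then have "pverts (lift W B F) \<subseteq> (\<lambda>k. 2 * k) ` W \<union> (\<lambda>k. 2 * k + 1) ` W"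
    unfolding subset_iff pverts_lift by blast
  moreover have "(\<lambda>k. 2 * k) ` W \<union> (\<lambda>k. 2 * k + 1) ` W \<subseteq> pverts (lift W B F)" by auto
  ultimately show ?thesis by (rule equalityI)
qed

lemma parcs_lift_image: "parcs (lift W B {}) =
    map_prod (\<lambda>k. 2 * k) (\<lambda>k. 2 * k) ` B \<union> map_prod (\<lambda>k. 2 * k + 1) (\<lambda>k. 2 * k + 1) ` B"
proof -
  have "(x, y) \<in> map_prod (\<lambda>k. 2 * k) (\<lambda>k. 2 * k) ` B \<union>
      map_prod (\<lambda>k. 2 * k + 1) (\<lambda>k. 2 * k + 1) ` B"
    if "(x div 2, y div 2) \<in> B" "even x = even y" for x y
    using that by (cases "even x") (force elim!: evenE oddE)+
  then have "parcs (lift W B {}) \<subseteq> map_prod (\<lambda>k. 2 * k) (\<lambda>k. 2 * k) ` B \<union>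
      map_prod (\<lambda>k. 2 * k + 1) (\<lambda>k. 2 * k + 1) ` B"
    by (intro subrelI) (simp only: arc_lift empty_iff not_False_eq_True simp_thms)
  moreover have "map_prod (\<lambda>k. 2 * k) (\<lambda>k. 2 * k) ` B \<union>
      map_prod (\<lambda>k. 2 * k + 1) (\<lambda>k. 2 * k + 1) ` B \<subseteq> parcs (lift W B {})" by auto
  ultimately show ?thesis by (rule equalityI)
qed

lemma card_pverts_lift:
  assumes "finite W"
  shows "card (pverts (lift W B F)) = 2 * card W"
proof -
  have "card (pverts (lift W B F)) = card ((\<lambda>k. 2 * k) ` W) + card ((\<lambda>k. 2 * k + 1) ` W)"
    unfolding pverts_lift_image using assms by (intro card_Un_disjoint) (auto, presburger)
  then show ?thesis by (simp add: card_image inj_on_def)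
qed

lemma card_parcs_lift:
  assumes "finite B"
  shows "card (parcs (lift W B {})) = 2 * card B"
proof -
  have "card (parcs (lift W B {})) = card (map_prod (\<lambda>k. 2 * k) (\<lambda>k. 2 * k) ` B) +
      card (map_prod (\<lambda>k. 2 * k + 1) (\<lambda>k. 2 * k + 1) ` B)"
    unfolding parcs_lift_image using assms by (intro card_Un_disjoint) (auto, presburger)
  moreover have "inj_on (map_prod (\<lambda>k::nat. 2 * k) (\<lambda>k::nat. 2 * k)) B"
      "inj_on (map_prod (\<lambda>k::nat. 2 * k + 1) (\<lambda>k::nat. 2 * k + 1)) B"
    by (auto simp: inj_on_def)
  ultimately show ?thesis by (simp only: card_image mult_2)
qed

text \<open>Over each base arc leaving \<open>x div 2\<close> there is exactly one arc leaving
  \<open>x\<close>; \<open>F\<close> only decides the parity of its head. Hence degrees do not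
  depend on \<open>F\<close>.\<close>

lemma bij_betw_out_lift:
  "bij_betw (\<lambda>y. y div 2) {y. (x, y) \<in> parcs (lift W B F)} {v. (x div 2, v) \<in> B}"
proof (rule bij_betw_imageI)
  show "inj_on (\<lambda>y. y div 2) {y. (x, y) \<in> parcs (lift W B F)}"
    by (auto simp: inj_on_def intro: eq_of_div_2_parity)
  have "v \<in> (\<lambda>y. y div 2) ` {y. (x, y) \<in> parcs (lift W B F)}" if "(x div 2, v) \<in> B" for v
  proof (cases "even x \<longleftrightarrow> (x div 2, v) \<notin> F")
    case True
    with that show ?thesis by (intro image_eqI[of _ _ "2 * v"]) auto
  next
    case False
    with that show ?thesis by (intro image_eqI[of _ _ "2 * v + 1"]) auto
  qed
  then show "(\<lambda>y. y div 2) ` {y. (x, y) \<in> parcs (lift W B F)} = {v. (x div 2, v) \<in> B}" by auto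
qed

lemma bij_betw_in_lift:
  "bij_betw (\<lambda>y. y div 2) {y. (y, x) \<in> parcs (lift W B F)} {v. (v, x div 2) \<in> B}"
proof (rule bij_betw_imageI)
  show "inj_on (\<lambda>y. y div 2) {y. (y, x) \<in> parcs (lift W B F)}"
    by (auto simp: inj_on_def intro: eq_of_div_2_parity)
  have "v \<in> (\<lambda>y. y div 2) ` {y. (y, x) \<in> parcs (lift W B F)}" if "(v, x div 2) \<in> B" for v
  proof (cases "even x \<longleftrightarrow> (v, x div 2) \<notin> F")
    case True
    with that show ?thesis by (intro image_eqI[of _ _ "2 * v"]) auto
  next
    case False
    with that show ?thesis by (intro image_eqI[of _ _ "2 * v + 1"]) auto
  qed
  then show "(\<lambda>y. y div 2) ` {y. (y, x) \<in> parcs (lift W B F)} = {v. (v, x div 2) \<in> B}" by auto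
qed

lemma out_degree_with_proj: "out_degree (with_proj G) x = card {y. (x, y) \<in> parcs G}"
proof -
  have "out_arcs (with_proj G) x = Pair x ` {y. (x, y) \<in> parcs G}"
    by (auto simp: out_arcs_def)
  then show ?thesis by (simp add: out_degree_def card_image inj_on_def)
qed

lemma in_degree_with_proj: "in_degree (with_proj G) x = card {y. (y, x) \<in> parcs G}"
proof -
  have "in_arcs (with_proj G) x = (\<lambda>y. (y, x)) ` {y. (y, x) \<in> parcs G}"
    by (auto simp: in_arcs_def)
  then show ?thesis by (simp add: in_degree_def card_image inj_on_def)
qed

lemma out_degree_lift: "out_degree (with_proj (lift W B F)) x = card {v. (x div 2, v) \<in> B}"
  unfolding out_degree_with_proj by (rule bij_betw_same_card[OF bij_betw_out_lift])

lemma in_degree_lift: "in_degree (with_proj (lift W B F)) x = card {v. (v, x div 2) \<in> B}"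
  unfolding in_degree_with_proj by (rule bij_betw_same_card[OF bij_betw_in_lift])

lemma walk_graph_lift:
  assumes "finite W" "B \<subseteq> W \<times> W" "\<And>u. u \<in> W \<Longrightarrow> \<exists>v. (u, v) \<in> B"
  shows "walk_graph (lift W B F)"
proof -
  have "finite (pverts (lift W B F))"
    using assms(1) by (simp add: pverts_lift_image)
  moreover have "parcs (lift W B F) \<subseteq> pverts (lift W B F) \<times> pverts (lift W B F)"
    using assms(2) by auto
  ultimately have "pair_fin_digraph (lift W B F)"
    by unfold_locales (auto intro: finite_subset)
  moreover have "out_degree (with_proj (lift W B F)) x \<ge> 1" if "x div 2 \<in> W" for x
  proof -
    have "{v. (x div 2, v) \<in> B} \<subseteq> W" using assms(2) by auto
    then have "finite {v. (x div 2, v) \<in> B}" using assms(1) finite_subset by blast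
    then have "card {v. (x div 2, v) \<in> B} > 0" using assms(3)[OF that] by (auto simp: card_gt_0_iff)
    then show ?thesis by (simp add: out_degree_lift)
  qed
  ultimately show ?thesis by (simp add: walk_graph_def)
qed

section \<open>Adjacency lists after crossing one base arc\<close>

definition flip_out :: "nat \<times> nat \<Rightarrow> nat \<Rightarrow> nat \<Rightarrow> nat" where
  "flip_out e x y = (if (x div 2, y div 2) = e then twin y else y)"

definition flip_in :: "nat \<times> nat \<Rightarrow> nat \<Rightarrow> nat \<Rightarrow> nat" where
  "flip_in e x y = (if (y div 2, x div 2) = e then twin y else y)"

text \<open>Every entry keeps its position, and only entries over \<open>e\<close> change, to the
  other copy. A list query therefore sees the crossing only if it reads such an entry.\<close>

definition flip_lists :: "nat \<times> nat \<Rightarrow> adj_lists \<Rightarrow> adj_lists" where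
  "flip_lists e L = \<lparr>in_list = (\<lambda>x. map (flip_in e x) (in_list L x)),
     out_list = (\<lambda>x. map (flip_out e x) (out_list L x)),
     sorted_in_list = (\<lambda>x. map (flip_in e x) (sorted_in_list L x))\<rparr>"

lemma flip_div_2 [simp]: "flip_out e x y div 2 = y div 2" "flip_in e x y div 2 = y div 2"
  by (auto simp: flip_out_def flip_in_def)

lemma flip_flip [simp]: "flip_out e x (flip_out e x y) = y" "flip_in e x (flip_in e x y) = y"
  by (auto simp: flip_out_def flip_in_def)

lemma inj_flip: "inj_on (flip_out e x) A" "inj_on (flip_in e x) A"
  by (metis flip_flip inj_on_inverseI)+

lemma flip_out_image:
  "flip_out e x ` {y. (x, y) \<in> parcs (lift W B {})} = {y. (x, y) \<in> parcs (lift W B {e})}"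
proof (intro equalityI subsetI)
  fix y assume "y \<in> {y. (x, y) \<in> parcs (lift W B {e})}"
  then show "y \<in> flip_out e x ` {y. (x, y) \<in> parcs (lift W B {})}"
    by (intro image_eqI[of _ _ "flip_out e x y"]) (auto simp: flip_out_def)
qed (auto simp: flip_out_def)

lemma flip_in_image:
  "flip_in e x ` {y. (y, x) \<in> parcs (lift W B {})} = {y. (y, x) \<in> parcs (lift W B {e})}"
proof (intro equalityI subsetI)
  fix y assume "y \<in> {y. (y, x) \<in> parcs (lift W B {e})}"
  then show "y \<in> flip_in e x ` {y. (y, x) \<in> parcs (lift W B {})}"
    by (intro image_eqI[of _ _ "flip_in e x y"]) (auto simp: flip_in_def)
qed (auto simp: flip_in_def)

text \<open>Flipping is injective and preserves the base node. The out-degree depends on the base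
  node only, so the sorted lists stay sorted.\<close>

lemma adj_lists_of_flip:
  assumes "adj_lists_of (lift W B {}) L"
  shows "adj_lists_of (lift W B {e}) (flip_lists e L)"
  unfolding adj_lists_of_def
proof (intro ballI)
  fix x assume "x \<in> pverts (lift W B {e})"
  then have x: "x \<in> pverts (lift W B {})" by simp
  have deg: "map (out_degree (with_proj (lift W B {e})) \<circ> flip_in e x) ys =
      map (out_degree (with_proj (lift W B {}))) ys" for ys
    by (simp add: out_degree_lift)
  show "distinct (in_list (flip_lists e L) x) \<and>
     set (in_list (flip_lists e L) x) = {v. (v, x) \<in> parcs (lift W B {e})} \<and>
     distinct (out_list (flip_lists e L) x) \<and>
     set (out_list (flip_lists e L) x) = {v. (x, v) \<in> parcs (lift W B {e})} \<and>
     distinct (sorted_in_list (flip_lists e L) x) \<and>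
     set (sorted_in_list (flip_lists e L) x) = {v. (v, x) \<in> parcs (lift W B {e})} \<and>
     sorted (map (out_degree (with_proj (lift W B {e}))) (sorted_in_list (flip_lists e L) x))"
    using assms[unfolded adj_lists_of_def, rule_format, OF x]
    by (simp only: flip_lists_def adj_lists.simps distinct_map set_map map_map deg inj_flip
        flip_out_image flip_in_image simp_thms)
qed

text \<open>An over-approximation of the queries that can detect the crossing of \<open>e\<close>.
  An index out of range makes \<open>!\<close> an unspecified value, which is harmless: each query
  still names at most one arc.\<close>

fun reveals :: "adj_lists \<Rightarrow> query \<Rightarrow> nat \<times> nat \<Rightarrow> bool" where
  "reveals L (IN x k) e \<longleftrightarrow> e = (in_list L x ! k div 2, x div 2)"
| "reveals L (OUT x k) e \<longleftrightarrow> e = (x div 2, out_list L x ! k div 2)"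
| "reveals L (ADJ x y) e \<longleftrightarrow> e = (x div 2, y div 2)"
| "reveals L (IN_SORTED x k) e \<longleftrightarrow> e = (sorted_in_list L x ! k div 2, x div 2)"
| "reveals L _ e \<longleftrightarrow> False"

text \<open>Node set and degrees do not depend on the crossed arcs, so degree queries and
  \<open>JUMP\<close> never help; every other query concerns a single base arc.\<close>

lemma reply_flip_eq:
  assumes "\<not> reveals L q e"
  shows "reply (lift W B {}) L q = reply (lift W B {e}) (flip_lists e L) q"
  using assms
  by (cases q) (auto simp: in_degree_lift out_degree_lift entry_def flip_lists_def
      flip_in_def flip_out_def pverts_lift_eq[of W B "{}" "{e}"])

lemma card_reveals_le: "card {e \<in> I. reveals L q e} \<le> 1"
proof -
  obtain e where "{e \<in> I. reveals L q e} \<subseteq> {e}"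
    by (cases q) auto
  then show ?thesis using card_mono[of "{e}"] by force
qed

section \<open>Discounted random walks\<close>

lemma finite_out_neighbours:
  assumes "walk_graph G" "u \<in> pverts G"
  shows "finite {v. (u, v) \<in> parcs G}" "{v. (u, v) \<in> parcs G} \<noteq> {}"
proof -
  have "card {v. (u, v) \<in> parcs G} > 0"
    using assms unfolding walk_graph_def out_degree_with_proj by force
  then show "finite {v. (u, v) \<in> parcs G}" "{v. (u, v) \<in> parcs G} \<noteq> {}"
    by (auto simp: card_gt_0_iff)
qed

lemma arc_in_pverts:
  assumes "walk_graph G" "(u, v) \<in> parcs G"
  shows "u \<in> pverts G" "v \<in> pverts G"
proof -
  interpret pair_fin_digraph G using assms(1) by (simp add: walk_graph_def)
  show "u \<in> pverts G" "v \<in> pverts G" using assms(2) in_arcsD1 in_arcsD2 by blast+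
qed

text \<open>By induction on the number of steps, the support of the walk stays inside
  \<open>C\<close>.\<close>

lemma ppr_eq_0_of_closed:
  assumes G: "walk_graph G" and "C \<subseteq> pverts G" and "s \<in> C" and "t \<notin> C"
    and closed: "\<And>u v. u \<in> C \<Longrightarrow> (u, v) \<in> parcs G \<Longrightarrow> v \<in> C"
  shows "ppr \<alpha> G s t = 0"
proof -
  have step: "set_pmf (walk_step \<alpha> G st) \<subseteq> At ` C \<union> Stopped ` C" if "st \<in> At ` C \<union> Stopped ` C" for st
  proof (cases st)
    case (At u)
    with that have "u \<in> C" by auto
    moreover have "u \<in> pverts G" using \<open>u \<in> C\<close> assms(2) by auto
    ultimately show ?thesis
      using At closed finite_out_neighbours[OF G]
      by (auto simp: set_pmf_of_set split: if_splits)
  next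
    case (Stopped u)
    with that show ?thesis by auto
  qed
  have "set_pmf (walk_after \<alpha> G s k) \<subseteq> At ` C \<union> Stopped ` C" for k
  proof (induction k)
    case 0
    then show ?case using \<open>s \<in> C\<close> by simp
  next
    case (Suc k)
    then show ?case using step unfolding walk_after.simps set_bind_pmf by blast
  qed
  then have "pmf (walk_after \<alpha> G s k) (Stopped t) = 0" for k
    using \<open>t \<notin> C\<close> by (fastforce simp: pmf_eq_0_set_pmf)
  then show ?thesis by (simp add: ppr_def)
qed

lemma pmf_bind_ge: "pmf M x * pmf (f x) y \<le> pmf (bind_pmf M f) y"
proof -
  have "ennreal (pmf M x * pmf (f x) y) = (\<integral>\<^sup>+x'. ennreal (pmf (f x) y) * indicator {x} x' \<partial>measure_pmf M)"
    by (simp add: nn_integral_cmult_indicator emeasure_pmf_single ennreal_mult' mult.commute)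
  also have "\<dots> \<le> (\<integral>\<^sup>+x'. ennreal (pmf (f x') y) \<partial>measure_pmf M)"
    by (intro nn_integral_mono) (auto simp: indicator_def)
  also have "\<dots> = ennreal (pmf (bind_pmf M f) y)"
    by (rule ennreal_pmf_bind[symmetric])
  finally show ?thesis by simp
qed

lemma pmf_walk_step_move:
  assumes "0 \<le> \<alpha>" "\<alpha> \<le> 1" "walk_graph G" "(u, v) \<in> parcs G"
  shows "(1 - \<alpha>) / card {v. (u, v) \<in> parcs G} \<le> pmf (walk_step \<alpha> G (At u)) (At v)"
proof -
  note out = finite_out_neighbours[OF assms(3) arc_in_pverts(1)[OF assms(3,4)]]
  have "pmf (map_pmf At (pmf_of_set {v. (u, v) \<in> parcs G})) (At v) = 1 / card {v. (u, v) \<in> parcs G}"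
    using out assms(4) by (subst pmf_map_inj') (auto simp: inj_def)
  then show ?thesis
    using assms(1,2)
    unfolding walk_step.simps by (intro order_trans[OF _ pmf_bind_ge[of _ False]]) simp
qed

lemma pmf_walk_step_stop:
  assumes "0 \<le> \<alpha>" "\<alpha> \<le> 1"
  shows "\<alpha> \<le> pmf (walk_step \<alpha> G (At u)) (Stopped u)"
  unfolding walk_step.simps
  by (rule order_trans[OF _ pmf_bind_ge[of _ True]]) (use assms in simp)

lemma pmf_walk_after_Suc_ge:
  assumes "a \<le> pmf (walk_after \<alpha> G s k) st" "b \<le> pmf (walk_step \<alpha> G st) st'" "0 \<le> b"
  shows "a * b \<le> pmf (walk_after \<alpha> G s (Suc k)) st'"
proof -
  have "a * b \<le> pmf (walk_after \<alpha> G s k) st * pmf (walk_step \<alpha> G st) st'"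
    using assms by (intro mult_mono) auto
  also have "\<dots> \<le> pmf (walk_after \<alpha> G s (Suc k)) st'"
    by (simp add: pmf_bind_ge)
  finally show ?thesis .
qed

lemma pmf_le_ppr: "pmf (walk_after \<alpha> G s k) (Stopped t) \<le> ppr \<alpha> G s t"
  unfolding ppr_def by (intro cSUP_upper bdd_aboveI[of _ 1]) (auto simp: pmf_le_1)

text \<open>The bound counts the single trajectory that moves from \<open>s\<close> to
  \<open>u\<close>, then to \<open>t\<close>, and stops there.\<close>

lemma ppr_two_steps_ge:
  assumes \<alpha>: "0 \<le> \<alpha>" "\<alpha> \<le> 1" and G: "walk_graph G"
    and arcs: "(s, u) \<in> parcs G" "(u, t) \<in> parcs G"
  shows "\<alpha> * (1 - \<alpha>)\<^sup>2 /
      (card {v. (s, v) \<in> parcs G} * card {v. (u, v) \<in> parcs G}) \<le> ppr \<alpha> G s t"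
proof -
  let ?a = "(1 - \<alpha>) / card {v. (s, v) \<in> parcs G}" and ?b = "(1 - \<alpha>) / card {v. (u, v) \<in> parcs G}"
  have "1 \<le> pmf (walk_after \<alpha> G s 0) (At s)" by simp
  from pmf_walk_after_Suc_ge[OF this pmf_walk_step_move[OF \<alpha> G arcs(1)]]
  have "1 * ?a \<le> pmf (walk_after \<alpha> G s (Suc 0)) (At u)" using \<alpha> by simp
  from pmf_walk_after_Suc_ge[OF this pmf_walk_step_move[OF \<alpha> G arcs(2)]]
  have "1 * ?a * ?b \<le> pmf (walk_after \<alpha> G s (Suc (Suc 0))) (At t)" using \<alpha> by simp
  from pmf_walk_after_Suc_ge[OF this pmf_walk_step_stop[OF \<alpha>]]
  have "1 * ?a * ?b * \<alpha> \<le> pmf (walk_after \<alpha> G s (Suc (Suc (Suc 0)))) (Stopped t)" using \<alpha> by simp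
  also have "\<dots> \<le> ppr \<alpha> G s t" by (rule pmf_le_ppr)
  finally show ?thesis by (simp add: power2_eq_square mult_ac)
qed

section \<open>The hard inputs\<close>

text \<open>The critical arcs are those in \<open>X \<times> Y\<close>. The source is the even copy
  of \<open>r\<close>, and the node tested for \<open>e\<close> is the odd copy of the head of
  \<open>e\<close>. The hypothesis \<open>small\<close> makes the probability of the path through
  the crossed arc at least \<open>\<delta> / (1 - \<epsilon>)\<close>.\<close>

lemma expected_time_lift_ge:
  fixes r :: nat and \<alpha> \<epsilon> \<delta> p\<^sub>f :: real
  assumes \<alpha>: "0 < \<alpha>" "\<alpha> < 1" and \<epsilon>: "0 < \<epsilon>" "\<epsilon> < 1" and p: "p\<^sub>f < 1/2"
    and W: "finite W" "B \<subseteq> W \<times> W" "\<And>u. u \<in> W \<Longrightarrow> \<exists>v. (u, v) \<in> B"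
    and r: "r \<in> W" "r \<notin> X" and out_r: "{v. (r, v) \<in> B} = X"
    and out_X: "\<And>u. u \<in> X \<Longrightarrow> {v. (u, v) \<in> B} = Y"
    and \<delta>: "0 < \<delta>" "\<delta> \<le> 1" and small: "card X * card Y * \<delta> \<le> \<alpha> * (1 - \<alpha>)\<^sup>2 * (1 - \<epsilon>)"
    and A: "solves_single_source \<alpha> \<epsilon> p\<^sub>f A" and L: "adj_lists_of (lift W B {}) L"
  shows "ennreal (real (card X * card Y) * ((1 - 2 * p\<^sub>f) / 2))
    \<le> expected_time (lift W B {}) L (A (pverts (lift W B {})) (2 * r) \<delta>)"
proof -
  let ?good = "\<lambda>G t e. \<not> \<bar>e t - ppr \<alpha> G (2 * r) t\<bar> \<ge> \<epsilon> * max (ppr \<alpha> G (2 * r) t) \<delta>"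
  let ?\<sigma> = "A (pverts (lift W B {})) (2 * r) \<delta>"
  let ?t = "\<lambda>e. 2 * snd e + 1 :: nat"
  have sub: "X \<subseteq> W" "X \<noteq> {}" "Y \<subseteq> W"
    using out_r out_X W(2) W(3)[OF r(1)] by blast+
  then have fin: "finite (X \<times> Y)" using W(1) finite_subset by blast
  note wg = walk_graph_lift[OF W]
  \<comment> \<open>All lifts have the same node set, so the algorithm gets the same arguments and
    runs the same strategy \<open>?\<sigma>\<close> on each of them.\<close>
  have solved: "1 - output_prob (lift W B F) L' ?\<sigma> (?good (lift W B F) t) \<le> p\<^sub>f"
    if "adj_lists_of (lift W B F) L'" "t div 2 \<in> W" for F L' t
    using A[unfolded solves_single_source_def, rule_format, of "lift W B F" L' "2 * r" \<delta> t]
      that wg r(1) \<delta> by (simp add: pverts_lift_eq[of W B F "{}"])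
  \<comment> \<open>Without crossed arcs the walk never changes parity, and the tested node is
    odd.\<close>
  have zero: "ppr \<alpha> (lift W B {}) (2 * r) (?t e) = 0" for e
    by (rule ppr_eq_0_of_closed[OF wg, of "{x \<in> pverts (lift W B {}). even x}"]) (use r W(2) in auto)
  have large: "\<delta> / (1 - \<epsilon>) \<le> ppr \<alpha> (lift W B {e}) (2 * r) (?t e)" if e: "e \<in> X \<times> Y" for e
  proof -
    obtain u v where uv: "e = (u, v)" "u \<in> X" "v \<in> Y" using e by auto
    have B: "(r, u) \<in> B" "(u, v) \<in> B" using out_r out_X[OF uv(2)] uv by blast+
    have pos: "0 < real (card X * card Y)"
      using fin e card_gt_0_iff[of "X \<times> Y"] by (auto simp flip: card_cartesian_product)
    have "\<alpha> * (1 - \<alpha>)\<^sup>2 / (card {y. (2 * r, y) \<in> parcs (lift W B {e})} *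
        card {y. (2 * u, y) \<in> parcs (lift W B {e})}) \<le> ppr \<alpha> (lift W B {e}) (2 * r) (2 * v + 1)"
      \<comment> \<open>As \<open>r \<notin> X\<close>, the arc from \<open>r\<close> to
        \<open>u\<close> is not the crossed one, so the walk changes copy exactly at its second
        move.\<close>
      using \<alpha> B r(2) uv by (intro ppr_two_steps_ge wg) auto
    also have "card {y. (2 * r, y) \<in> parcs (lift W B {e})} = card X"
      using out_degree_lift[of W B "{e}" "2 * r"] out_r by (simp add: out_degree_with_proj)
    also have "card {y. (2 * u, y) \<in> parcs (lift W B {e})} = card Y"
      using out_degree_lift[of W B "{e}" "2 * u"] out_X[OF uv(2)] by (simp add: out_degree_with_proj)
    finally have "\<alpha> * (1 - \<alpha>)\<^sup>2 / real (card X * card Y) \<le> ppr \<alpha> (lift W B {e}) (2 * r) (?t e)"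
      using uv by simp
    moreover have "\<delta> / (1 - \<epsilon>) \<le> \<alpha> * (1 - \<alpha>)\<^sup>2 / real (card X * card Y)"
      using small pos \<epsilon> by (simp add: pos_divide_le_eq pos_le_divide_eq mult_ac del: of_nat_mult)
    ultimately show ?thesis by linarith
  qed
  have "ennreal (real (card (X \<times> Y)) * ((1 - 2 * p\<^sub>f) / 2)) \<le> expected_time (lift W B {}) L ?\<sigma>"
  proof (rule expected_time_ge_of_indistinguishable[where D = "\<lambda>e q. reveals L q e"
        and G' = "\<lambda>e. lift W B {e}" and L' = "\<lambda>e. flip_lists e L"
        and P = "\<lambda>e. ?good (lift W B {}) (?t e)" and Q = "\<lambda>e. ?good (lift W B {e}) (?t e)"])
    show "1 - output_prob (lift W B {}) L ?\<sigma> (?good (lift W B {}) (?t e)) \<le> p\<^sub>f" if "e \<in> X \<times> Y" for e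
      using that sub by (intro solved L) auto
    show "1 - output_prob (lift W B {e}) (flip_lists e L) ?\<sigma> (?good (lift W B {e}) (?t e)) \<le> p\<^sub>f"
      if "e \<in> X \<times> Y" for e
      using that sub by (intro solved adj_lists_of_flip L) auto
    show False if e: "e \<in> X \<times> Y" and P: "?good (lift W B {}) (?t e) f"
      and Q: "?good (lift W B {e}) (?t e) f" for e f
    proof -
      let ?\<pi> = "ppr \<alpha> (lift W B {e}) (2 * r) (?t e)"
      \<comment> \<open>A good estimate is below \<open>\<epsilon> * \<delta>\<close> on the
        uncrossed input and above \<open>(1 - \<epsilon>) * ?\<pi> \<ge> \<delta>\<close> on the
        crossed one.\<close>
      have "\<delta> \<le> (1 - \<epsilon>) * ?\<pi>" using large[OF e] \<epsilon> by (simp add: field_simps)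
      moreover have "\<delta> \<le> \<delta> / (1 - \<epsilon>)" using \<epsilon> \<delta> by (simp add: field_simps)
      then have "max ?\<pi> \<delta> = ?\<pi>" using large[OF e] by simp
      moreover have "f (?t e) < \<epsilon> * \<delta>" using P \<delta> unfolding zero by simp
      moreover have "\<epsilon> * \<delta> \<le> \<delta>" using \<epsilon> \<delta> by simp
      ultimately show False using Q by (simp add: algebra_simps)
    qed
  qed (use fin reply_flip_eq card_reveals_le p in auto)
  then show ?thesis by (simp add: card_cartesian_product)
qed

section \<open>The base digraph and the choice of its parameters\<close>

text \<open>Root, middle layer of size \<open>p\<close>, last layer of size \<open>q\<close>. The
  loops on the last layer let the walk continue there; \<open>R\<close> is filler on separate nodes
  that adjusts the numbers of nodes and arcs.\<close>

definition base_arcs :: "nat \<Rightarrow> nat \<Rightarrow> (nat \<times> nat) set \<Rightarrow> (nat \<times> nat) set" where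
  "base_arcs p q R = {0} \<times> {1..p} \<union> {1..p} \<times> {p+1..p+q} \<union> Id_on {p+1..p+q} \<union> R"

lemma card_base_arcs:
  assumes R: "R \<subseteq> {p+q+1..p+q+n} \<times> {p+q+1..p+q+n}"
  shows "finite (base_arcs p q R)" "card (base_arcs p q R) = p + p * q + q + card R"
proof -
  have fin: "finite R" using R finite_subset by blast
  have id: "Id_on {p+1..p+q} = (\<lambda>k. (k, k)) ` {p+1..p+q}" by auto
  then have fin_id: "finite (Id_on {p+1..p+q})" by simp
  show "finite (base_arcs p q R)" using fin fin_id by (simp add: base_arcs_def)
  have "card (base_arcs p q R) = card ({0::nat} \<times> {1..p} \<union> {1..p} \<times> {p+1..p+q} \<union> Id_on {p+1..p+q}) + card R"
    unfolding base_arcs_def using R fin fin_id by (intro card_Un_disjoint) auto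
  also have "card ({0::nat} \<times> {1..p} \<union> {1..p} \<times> {p+1..p+q} \<union> Id_on {p+1..p+q}) =
      card ({0::nat} \<times> {1..p} \<union> {1..p} \<times> {p+1..p+q}) + card (Id_on {p+1..p+q})"
    using fin_id by (intro card_Un_disjoint) auto
  also have "card ({0::nat} \<times> {1..p} \<union> {1..p} \<times> {p+1..p+q}) = p + p * q"
    by (subst card_Un_disjoint) (auto simp: card_cartesian_product)
  also have "card (Id_on {p+1..p+q}) = q"
    unfolding id by (simp add: card_image inj_on_def)
  finally show "card (base_arcs p q R) = p + p * q + q + card R" by simp
qed

text \<open>Up to a factor of 2, \<open>r\<close> critical arcs fit between two layers of at most
  \<open>n\<close> nodes. With \<open>p = min n r\<close> and \<open>q = r div p\<close>, the
  remainder lost is below \<open>p \<le> p * q\<close>.\<close>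

lemma exists_rectangle:
  fixes n r :: nat
  assumes "1 \<le> n" "1 \<le> r" "r \<le> n\<^sup>2"
  obtains p q where "1 \<le> p" "p \<le> n" "1 \<le> q" "q \<le> n" "p * q \<le> r" "r \<le> 2 * (p * q)"
proof
  let ?p = "min n r" and ?q = "r div min n r"
  show p: "1 \<le> ?p" "?p \<le> n" using assms by auto
  then show q: "1 \<le> ?q" using div_le_mono[of ?p r ?p] by (simp add: min_def split: if_splits)
  show "?q \<le> n"
    using assms div_le_mono[of r "n * n" n] by (auto simp: min_def power2_eq_square)
  show "?p * ?q \<le> r" by simp
  have "r = ?p * ?q + r mod ?p" by simp
  moreover have "r mod ?p < ?p" using p(1) by (intro mod_less_divisor) linarith
  moreover have "?p * 1 \<le> ?p * ?q" using q by (intro mult_le_mono2)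
  ultimately show "r \<le> 2 * (?p * ?q)" by linarith
qed

theorem theorem4p1:
  fixes \<alpha> \<epsilon> p\<^sub>f :: real
  assumes "0 < \<alpha>" "\<alpha> < 1" and "0 < \<epsilon>" "\<epsilon> < 1" and "0 < p\<^sub>f" "p\<^sub>f < 1 / 2"
  shows "\<exists>a\<^sub>1 a\<^sub>2 b\<^sub>1 b\<^sub>2 c :: real. 0 < a\<^sub>1 \<and> 0 < a\<^sub>2 \<and> 0 < b\<^sub>1 \<and> 0 < b\<^sub>2 \<and> 0 < c \<and>
    (\<forall>(n::nat) (m::nat) (\<delta>::real).
       1 \<le> n \<and> n \<le> m \<and> m \<le> n\<^sup>2 \<and> 0 < \<delta> \<and> \<delta> \<le> 1 \<longrightarrow>
       (\<exists>G s. walk_graph G \<and> s \<in> pverts G \<and>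
          a\<^sub>1 * real n \<le> real (card (pverts G)) \<and> real (card (pverts G)) \<le> a\<^sub>2 * real n \<and>
          b\<^sub>1 * real m \<le> real (card (parcs G)) \<and> real (card (parcs G)) \<le> b\<^sub>2 * real m \<and>
          (\<forall>A L. solves_single_source \<alpha> \<epsilon> p\<^sub>f A \<and> adj_lists_of G L \<longrightarrow>
             ennreal (c * min (real m) (1 / \<delta>))
               \<le> expected_time G L (A (pverts G) s \<delta>))))"
proof -
  define C where "C = \<alpha> * (1 - \<alpha>)\<^sup>2 * (1 - \<epsilon>)"
  define \<eta> where "\<eta> = (1 - 2 * p\<^sub>f) / 2"
  have "(1 - \<alpha>)\<^sup>2 \<le> 1" using assms by (simp add: power_le_one)
  then have "C \<le> 1 * 1 * 1" unfolding C_def using assms by (intro mult_mono) auto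
  then have C: "0 < C" "C \<le> 1" using assms by (auto simp: C_def)
  have \<eta>: "0 < \<eta>" "\<eta> \<le> 1" using assms by (auto simp: \<eta>_def)
  have "\<exists>G s. walk_graph G \<and> s \<in> pverts G \<and>
      1 * real n \<le> real (card (pverts G)) \<and> real (card (pverts G)) \<le> 8 * real n \<and>
      1 * real m \<le> real (card (parcs G)) \<and> real (card (parcs G)) \<le> 8 * real m \<and>
      (\<forall>A L. solves_single_source \<alpha> \<epsilon> p\<^sub>f A \<and> adj_lists_of G L \<longrightarrow>
         ennreal (C * \<eta> / 4 * min (real m) (1 / \<delta>)) \<le> expected_time G L (A (pverts G) s \<delta>))"
    if nm: "1 \<le> n" "n \<le> m" "m \<le> n\<^sup>2" and \<delta>: "0 < \<delta>" "\<delta> \<le> 1" for n m :: nat and \<delta> :: real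
  proof -
    \<comment> \<open>The target number of critical arcs: at most \<open>m\<close> to keep the arc
      count linear in \<open>m\<close>, and about \<open>C / \<delta>\<close> so that
      \<open>small\<close> can hold. The \<open>max 1\<close> keeps both layers nonempty when
      \<open>C / \<delta> < 1\<close>.\<close>
    define r where "r = max 1 (nat \<lfloor>min (real m) (C / \<delta>)\<rfloor>)"
    have "nat \<lfloor>min (real m) (C / \<delta>)\<rfloor> \<le> m" by linarith
    then have r: "1 \<le> r" "r \<le> m" using nm by (auto simp: r_def)
    obtain p q where pq: "1 \<le> p" "p \<le> n" "1 \<le> q" "q \<le> n" "p * q \<le> r" "r \<le> 2 * (p * q)"
      using exists_rectangle[of n r] nm r by auto
    define P where "P = {p+q+1..p+q+n}"
    have "card (Id_on P) = n"
    proof -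
      have "Id_on P = (\<lambda>k. (k, k)) ` P" by auto
      then show ?thesis by (simp add: P_def card_image inj_on_def)
    qed
    \<comment> \<open>The \<open>n\<close> loops give each filler node an out-neighbour;
      \<open>n \<le> m \<le> n\<^sup>2\<close> leaves room for exactly \<open>m\<close>
      arcs.\<close>
    then obtain R where R: "Id_on P \<subseteq> R" "R \<subseteq> P \<times> P" "card R = m"
      using exists_subset_between[of "Id_on P" m "P \<times> P"] nm
      by (auto simp: P_def card_cartesian_product power2_eq_square)
    define W where "W = {..p+q+n}"
    define B where "B = base_arcs p q R"
    have B: "finite B" "card B = p + p * q + q + m"
      using card_base_arcs[of R p q n] R by (simp_all add: B_def P_def)
    have W: "finite W" "B \<subseteq> W \<times> W" "0 \<in> W"
      using R(2) by (auto simp: W_def B_def base_arcs_def P_def)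
    have succ: "\<exists>v. (u, v) \<in> B" if "u \<in> W" for u
    proof -
      consider "u = 0" | "u \<in> {1..p}" | "u \<in> {p+1..p+q}" | "u \<in> P"
        using \<open>u \<in> W\<close> by (auto simp: W_def P_def) linarith
      then show ?thesis
      proof cases
        case 1
        then have "(u, 1) \<in> B" using pq by (simp add: B_def base_arcs_def)
        then show ?thesis ..
      next
        case 2
        then have "(u, p + 1) \<in> B" using pq by (simp add: B_def base_arcs_def)
        then show ?thesis ..
      next
        case 3
        then have "(u, u) \<in> B" by (simp add: B_def base_arcs_def Id_on_iff)
        then show ?thesis ..
      next
        case 4
        then have "(u, u) \<in> B" using R(1) by (auto simp: B_def base_arcs_def)
        then show ?thesis ..
      qed
    qed
    let ?G = "lift W B {}"
    \<comment> \<open>Each of \<open>p\<close>, \<open>q\<close> and \<open>p * q\<close> is at most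
      \<open>r \<le> m\<close>, so the base has between \<open>m\<close> and \<open>4 * m\<close>
      arcs; the lift doubles this.\<close>
    have "p \<le> p * q" "q \<le> p * q" using pq by simp_all
    then have "card B \<le> 4 * m" "m \<le> card B"
      using B(2) pq(5) r(2) by linarith+
    then have arcs: "m \<le> card (parcs ?G)" "card (parcs ?G) \<le> 8 * m"
      using B(1) by (simp_all add: card_parcs_lift)
    have verts: "n \<le> card (pverts ?G)" "card (pverts ?G) \<le> 8 * n"
      using W pq nm by (simp_all add: card_pverts_lift W_def)
    have time: "ennreal (C * \<eta> / 4 * min (real m) (1 / \<delta>)) \<le> expected_time ?G L (A (pverts ?G) 0 \<delta>)"
      if A: "solves_single_source \<alpha> \<epsilon> p\<^sub>f A" "adj_lists_of ?G L" for A L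
    proof (cases "C < \<delta>")
      case True
      \<comment> \<open>For \<open>C < \<delta>\<close> the claimed bound is below 1, and every run
        takes at least one unit of time.\<close>
      have "C * \<eta> / 4 * min (real m) (1 / \<delta>) \<le> C * \<eta> / 4 * (1 / \<delta>)"
        using C \<eta> by (intro mult_left_mono) auto
      also have "\<dots> = C / \<delta> * \<eta> / 4" by simp
      also have "\<dots> \<le> 1 * 1 / 4"
        using True \<delta> C \<eta> by (intro divide_right_mono mult_mono) auto
      finally have "ennreal (C * \<eta> / 4 * min (real m) (1 / \<delta>)) \<le> ennreal 1"
        by (intro ennreal_leI) simp
      then show ?thesis using one_le_expected_time by (metis ennreal_1 order_trans)
    next
      case False
      \<comment> \<open>Rounding down a number that is at least 1 loses at most a factor of 2, and
        the \<open>max 1\<close> has no effect.\<close>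
      then have "1 \<le> min (real m) (C / \<delta>)" using \<delta> nm by simp
      then have r': "real r \<le> min (real m) (C / \<delta>)" "min (real m) (C / \<delta>) \<le> 2 * real r"
        unfolding r_def by linarith+
      have out: "{v. (0, v) \<in> B} = {1..p}" "{v. (u, v) \<in> B} = {p+1..p+q}" if "u \<in> {1..p}" for u
        using R(2) that pq by (auto simp: B_def base_arcs_def P_def)
      have "real (p * q) \<le> C / \<delta>" using r'(1) pq(5) by linarith
      then have "real (card {1..p} * card {p+1..p+q}) * \<delta> \<le> C" using \<delta> by (simp add: field_simps)
      then have bound: "ennreal (real (card {1..p} * card {p+1..p+q}) * ((1 - 2 * p\<^sub>f) / 2))
          \<le> expected_time ?G L (A (pverts ?G) (2 * 0) \<delta>)"
        using assms \<delta> W succ out pq A unfolding C_def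
        by (intro expected_time_lift_ge[where \<alpha> = \<alpha> and \<epsilon> = \<epsilon>]) auto
      \<comment> \<open>Since \<open>C \<le> 1\<close>, the factor moves inside the minimum.
        Rounding and the rectangle each lose a factor of 2, whence the 4 in the final
        constant.\<close>
      have "C * min (real m) (1 / \<delta>) \<le> min (real m) (C / \<delta>)"
        proof (rule min.boundedI)
        have "C * min (real m) (1 / \<delta>) \<le> 1 * real m" using C by (intro mult_mono) (use \<delta> in auto)
        then show "C * min (real m) (1 / \<delta>) \<le> real m" by simp
        have "C * min (real m) (1 / \<delta>) \<le> C * (1 / \<delta>)" using C by (intro mult_left_mono) auto
        then show "C * min (real m) (1 / \<delta>) \<le> C / \<delta>" by simp
      qed
      also have "\<dots> \<le> 4 * real (p * q)" using r'(2) pq(6) by linarith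
      finally have "\<eta> / 4 * (C * min (real m) (1 / \<delta>)) \<le> \<eta> / 4 * (4 * real (p * q))"
        using \<eta> by (intro mult_left_mono) auto
      then have "ennreal (C * \<eta> / 4 * min (real m) (1 / \<delta>)) \<le> ennreal (real (p * q) * \<eta>)"
        by (intro ennreal_leI) (simp add: mult_ac)
      also have "\<dots> \<le> expected_time ?G L (A (pverts ?G) 0 \<delta>)"
        using bound by (simp add: \<eta>_def)
      finally show ?thesis .
    qed
    show ?thesis
    proof (intro exI conjI allI impI)
      show "walk_graph ?G" by (rule walk_graph_lift[OF W(1,2) succ])
      show "(0::nat) \<in> pverts ?G" using W(3) by simp
    qed (use arcs verts time in \<open>auto simp flip: of_nat_le_iff\<close>)
  qed
  moreover have "0 < C * \<eta> / 4" using C \<eta> by simp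
  ultimately show ?thesis
    by (intro exI[of _ 1] exI[of _ 8] exI[of _ 1] exI[of _ 8] exI[of _ "C * \<eta> / 4"]) auto
qed

end
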